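(* Let $\mathrm{CBase}$ be the cyclic proof system described in the context, over the language with constant symbols $s, e$, a unary function symbol $\mathrm{next}$, and the unary inductive predicate symbols $\mathrm{TeF}$ and $\mathrm{FsT}$. Then: (1) the sequent $\mathrm{TeF}(s) \vdash \mathrm{FsT}(e)$ is provable in $\mathrm{CBase}$; (2) the sequent $\mathrm{TeF}(s) \vdash \mathrm{FsT}(e)$ is not cut-free provable in $\mathrm{CBase}$, i.e. there is no $\mathrm{CBase}$ proof of it that does not use the rule (Cut).
   Context: Language: terms are built from variables, the constants $s$ ("start") and $e$ ("end"), and the unary function symbol $\mathrm{next}$ (write $\mathrm{next}^n t$ for $n$-fold application). Formulas are atomic only: $t = u$, $\mathrm{TeF}(t)$, $\mathrm{FsT}(t)$. The inductive predicates are given by the productions: $\mathrm{TeF}(e)$ holds; $\mathrm{TeF}(\mathrm{next}\,x)$ implies $\mathrm{TeF}(x)$; $\mathrm{FsT}(s)$ holds; $\mathrm{FsT}(x)$ implies $\mathrm{FsT}(\mathrm{next}\,x)$. A sequent $\Gamma \vdash \Delta$ consists of two finite sets of formulas (so contraction is implicit). Inference rules: (Axiom) $\Gamma\vdash\Delta$ with no premises if $\Gamma\cap\Delta\neq\emptyset$; (Weak) from $\Gamma'\vdash\Delta'$ infer $\Gamma\vdash\Delta$ when $\Gamma'\subseteq\Gamma$, $\Delta'\subseteq\Delta$; (Cut) from $\Gamma\vdash\varphi,\Delta$ and $\Gamma,\varphi\vdash\Delta$ infer $\Gamma\vdash\Delta$; (Subst) from $\Gamma\vdash\Delta$ infer $\Gamma[\theta]\vdash\Delta[\theta]$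 for a substitution $\theta$; (=L') from $\Gamma[x:=u,y:=t], t=u \vdash \Delta[x:=u,y:=t]$ infer $\Gamma[x:=t,y:=u], t=u\vdash\Delta[x:=t,y:=u]$; (=R) $\Gamma\vdash t=t,\Delta$ with no premises; (TeF R$_1$) $\Gamma\vdash\Delta,\mathrm{TeF}(e)$ with no premises; (TeF R$_2$) from $\Gamma\vdash\Delta,\mathrm{TeF}(\mathrm{next}\,t)$ infer $\Gamma\vdash\Delta,\mathrm{TeF}(t)$; (FsT R$_1$) $\Gamma\vdash\Delta,\mathrm{FsT}(s)$ with no premises; (FsT R$_2$) from $\Gamma\vdash\Delta,\mathrm{FsT}(t)$ infer $\Gamma\vdash\Delta,\mathrm{FsT}(\mathrm{next}\,t)$; (Case TeF) from $\Gamma, t=e\vdash\Delta$ and $\Gamma, t=y, \mathrm{TeF}(\mathrm{next}\,y)\vdash\Delta$ infer $\Gamma,\mathrm{TeF}(t)\vdash\Delta$, with $y$ fresh; (Case FsT) from $\Gamma, t=s\vdash\Delta$ and $\Gamma, t=\mathrm{next}\,y, \mathrm{FsT}(y)\vdash\Delta$ infer $\Gamma,\mathrm{FsT}(t)\vdash\Delta$, with $y$ fresh. In the Case rules, $\mathrm{TeF}(\mathrm{next}\,y)$ (resp. $\mathrm{FsT}(y)$) is the case-descendant of the principal formula $\mathrm{TeF}(t)$ (resp. $\mathrm{FsT}(t)$). A $\mathrm{CBase}$ pre-proof is a finite derivation tree built from these rules in which some leaves are "buds" (not closed by a rule), together with a map assigning to each bud a companion: an inner node labelled by the same sequent. Its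 tree-unfolding is the (possibly infinite) derivation tree obtained by repeatedly replacing each bud by a copy of the subtree rooted at its companion. A trace along a path $(\Gamma_i\vdash\Delta_i)_i$ is a sequence $(\tau_i)$ with $\tau_i$ an inductive-predicate atom in $\Gamma_i$ such that: if the rule at $i$ is (Subst) with $\theta$ then $\tau_i=\tau_{i+1}[\theta]$; if it is (=L') with principal $t=u$ and $\tau_i=\varphi[x:=t,y:=u]$ then $\tau_{i+1}=\varphi[x:=u,y:=t]$; if it is a Case rule then either $\tau_i$ is the principal formula and $\tau_{i+1}$ is its case-descendant (then $i$ is a progress point) or $\tau_{i+1}=\tau_i$; for any other rule $\tau_{i+1}=\tau_i$. A pre-proof is a $\mathrm{CBase}$ proof if its tree-unfolding satisfies the global trace condition: every infinite path has a tail followed by some trace with infinitely many progress points. A sequent is (cut-free) provable if it has a $\mathrm{CBase}$ proof (not using (Cut)). *)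

theory Defs
  imports Main "HOL-Library.FSet"
begin

datatype tm = Var nat | Start | End | Next tm

datatype fm = Eq tm tm (infix "\<doteq>" 60) | TeF tm | FsT tm

primrec subst_tm :: "(nat \<Rightarrow> tm) \<Rightarrow> tm \<Rightarrow> tm" where
  "subst_tm \<theta> (Var x) = \<theta> x"
| "subst_tm \<theta> Start = Start"
| "subst_tm \<theta> End = End"
| "subst_tm \<theta> (Next t) = Next (subst_tm \<theta> t)"

primrec subst_fm :: "(nat \<Rightarrow> tm) \<Rightarrow> fm \<Rightarrow> fm" where
  "subst_fm \<theta> (t \<doteq> u) = (subst_tm \<theta> t \<doteq> subst_tm \<theta> u)"
| "subst_fm \<theta> (TeF t) = TeF (subst_tm \<theta> t)"
| "subst_fm \<theta> (FsT t) = FsT (subst_tm \<theta> t)"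

abbreviation subst_fms :: "(nat \<Rightarrow> tm) \<Rightarrow> fm fset \<Rightarrow> fm fset" where
  "subst_fms \<theta> \<Gamma> \<equiv> subst_fm \<theta> |`| \<Gamma>"

text \<open>The simultaneous substitution \<open>[x := t, y := u]\<close>; it is only used with \<open>x \<noteq> y\<close>.\<close>

definition subst2 :: "nat \<Rightarrow> tm \<Rightarrow> nat \<Rightarrow> tm \<Rightarrow> nat \<Rightarrow> tm" where
  "subst2 x t y u = Var(x := t, y := u)"

primrec vars_tm :: "tm \<Rightarrow> nat set" where
  "vars_tm (Var x) = {x}"
| "vars_tm Start = {}"
| "vars_tm End = {}"
| "vars_tm (Next t) = vars_tm t"

primrec vars_fm :: "fm \<Rightarrow> nat set" where
  "vars_fm (t \<doteq> u) = vars_tm t \<union> vars_tm u"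
| "vars_fm (TeF t) = vars_tm t"
| "vars_fm (FsT t) = vars_tm t"

definition vars_fms :: "fm fset \<Rightarrow> nat set" where
  "vars_fms \<Gamma> = (\<Union>\<phi> \<in> fset \<Gamma>. vars_fm \<phi>)"

datatype sequent = Sequent (ante: "fm fset") (succ: "fm fset") (infix "\<turnstile>" 50)

text \<open>A rule name carries the parameters of the rule instance that traces refer to. The contexts
  \<open>\<Gamma>\<close>, \<open>\<Delta>\<close> of an instance are not recorded: as antecedents and succedents are sets, the
  context of an instance may contain its principal formula.\<close>

datatype rule =
    Axiom
  | Weak
  | Cut fm
  | Subst "nat \<Rightarrow> tm"
  | EqL nat nat tm tm
  | EqR tm
  | TeFR1
  | TeFR2 tm
  | FsTR1
  | FsTR2 tm
  | CaseTeF tm nat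
  | CaseFsT tm nat

inductive inference :: "rule \<Rightarrow> sequent list \<Rightarrow> sequent \<Rightarrow> bool" where
  Axiom: "\<Gamma> |\<inter>| \<Delta> \<noteq> {||} \<Longrightarrow> inference Axiom [] (\<Gamma> \<turnstile> \<Delta>)"
| Weak: "\<Gamma>' |\<subseteq>| \<Gamma> \<Longrightarrow> \<Delta>' |\<subseteq>| \<Delta> \<Longrightarrow> inference Weak [\<Gamma>' \<turnstile> \<Delta>'] (\<Gamma> \<turnstile> \<Delta>)"
| Cut: "inference (Cut \<phi>) [\<Gamma> \<turnstile> finsert \<phi> \<Delta>, finsert \<phi> \<Gamma> \<turnstile> \<Delta>] (\<Gamma> \<turnstile> \<Delta>)"
| Subst: "inference (Subst \<theta>) [\<Gamma> \<turnstile> \<Delta>] (subst_fms \<theta> \<Gamma> \<turnstile> subst_fms \<theta> \<Delta>)"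
| EqL: "x \<noteq> y \<Longrightarrow> inference (EqL x y t u)
    [finsert (t \<doteq> u) (subst_fms (subst2 x u y t) \<Gamma>) \<turnstile> subst_fms (subst2 x u y t) \<Delta>]
    (finsert (t \<doteq> u) (subst_fms (subst2 x t y u) \<Gamma>) \<turnstile> subst_fms (subst2 x t y u) \<Delta>)"
| EqR: "inference (EqR t) [] (\<Gamma> \<turnstile> finsert (t \<doteq> t) \<Delta>)"
| TeFR1: "inference TeFR1 [] (\<Gamma> \<turnstile> finsert (TeF End) \<Delta>)"
| TeFR2: "inference (TeFR2 t) [\<Gamma> \<turnstile> finsert (TeF (Next t)) \<Delta>] (\<Gamma> \<turnstile> finsert (TeF t) \<Delta>)"
| FsTR1: "inference FsTR1 [] (\<Gamma> \<turnstile> finsert (FsT Start) \<Delta>)"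
| FsTR2: "inference (FsTR2 t) [\<Gamma> \<turnstile> finsert (FsT t) \<Delta>] (\<Gamma> \<turnstile> finsert (FsT (Next t)) \<Delta>)"
| CaseTeF: "y \<notin> vars_fms \<Gamma> \<union> vars_tm t \<union> vars_fms \<Delta> \<Longrightarrow> inference (CaseTeF t y)
    [finsert (t \<doteq> End) \<Gamma> \<turnstile> \<Delta>,
     finsert (t \<doteq> Var y) (finsert (TeF (Next (Var y))) \<Gamma>) \<turnstile> \<Delta>]
    (finsert (TeF t) \<Gamma> \<turnstile> \<Delta>)"
| CaseFsT: "y \<notin> vars_fms \<Gamma> \<union> vars_tm t \<union> vars_fms \<Delta> \<Longrightarrow> inference (CaseFsT t y)
    [finsert (t \<doteq> Start) \<Gamma> \<turnstile> \<Delta>,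
     finsert (t \<doteq> Next (Var y)) (finsert (FsT (Var y)) \<Gamma>) \<turnstile> \<Delta>]
    (finsert (FsT t) \<Gamma> \<turnstile> \<Delta>)"

datatype ptree = Bud (concl: sequent) | Inf (concl: sequent) rule "ptree list"

text \<open>Nodes of a tree are addressed by lists of child indices, read from the root.\<close>

fun subtree_at :: "ptree \<Rightarrow> nat list \<Rightarrow> ptree option" where
  "subtree_at T [] = Some T"
| "subtree_at (Bud S) (i # p) = None"
| "subtree_at (Inf S r Ts) (i # p) = (if i < length Ts then subtree_at (Ts ! i) p else None)"

text \<open>The companion map \<open>c\<close> is only relevant on positions of buds. A companion need not be an
  ancestor of its bud, but it must be an inner node, i.e. have at least one child.\<close>

definition pre_proof :: "ptree \<Rightarrow> (nat list \<Rightarrow> nat list) \<Rightarrow> bool" where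
  "pre_proof T c \<longleftrightarrow>
     (\<forall>p S r Ts. subtree_at T p = Some (Inf S r Ts) \<longrightarrow> inference r (map concl Ts) S) \<and>
     (\<forall>p S. subtree_at T p = Some (Bud S) \<longrightarrow>
        (\<exists>r Ts. subtree_at T (c p) = Some (Inf S r Ts) \<and> Ts \<noteq> []))"

definition cut_free :: "ptree \<Rightarrow> bool" where
  "cut_free T \<longleftrightarrow> (\<nexists>p S \<phi> Ts. subtree_at T p = Some (Inf S (Cut \<phi>) Ts))"

codatatype dtree = Deriv (root_sequent: sequent) (root_rule: rule) (children: "dtree list")

definition jump :: "ptree \<Rightarrow> (nat list \<Rightarrow> nat list) \<Rightarrow> nat list \<Rightarrow> nat list" where
  "jump T c p = (case subtree_at T p of Some (Bud S) \<Rightarrow> c p | _ \<Rightarrow> p)"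

text \<open>The (possibly infinite) derivation tree obtained from the subtree of \<open>T\<close> at \<open>p\<close> by repeatedly
  replacing buds by the subtrees at their companions. If \<open>p\<close> is a node of a pre-proof, \<open>jump T c p\<close>
  always carries a rule, so the default branch is never taken there.\<close>

primcorec unfolding_at :: "ptree \<Rightarrow> (nat list \<Rightarrow> nat list) \<Rightarrow> nat list \<Rightarrow> dtree" where
  "unfolding_at T c p =
     (case subtree_at T (jump T c p) of
        Some (Inf S r Ts) \<Rightarrow>
          Deriv S r (map (\<lambda>i. unfolding_at T c (jump T c p @ [i])) [0..<length Ts])
      | _ \<Rightarrow> Deriv undefined undefined [])"

abbreviation tree_unfolding :: "ptree \<Rightarrow> (nat list \<Rightarrow> nat list) \<Rightarrow> dtree" where
  "tree_unfolding T c \<equiv> unfolding_at T c []"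

definition infinite_path :: "dtree \<Rightarrow> (nat \<Rightarrow> dtree) \<Rightarrow> bool" where
  "infinite_path D \<pi> \<longleftrightarrow> \<pi> 0 = D \<and> (\<forall>i. \<pi> (Suc i) \<in> set (children (\<pi> i)))"

fun progress :: "rule \<Rightarrow> fm \<Rightarrow> fm \<Rightarrow> bool" where
  "progress (CaseTeF t y) \<tau> \<tau>' \<longleftrightarrow> \<tau> = TeF t \<and> \<tau>' = TeF (Next (Var y))"
| "progress (CaseFsT t y) \<tau> \<tau>' \<longleftrightarrow> \<tau> = FsT t \<and> \<tau>' = FsT (Var y)"
| "progress _ \<tau> \<tau>' \<longleftrightarrow> False"

fun trace_step :: "rule \<Rightarrow> fm \<Rightarrow> fm \<Rightarrow> bool" where
  "trace_step (Subst \<theta>) \<tau> \<tau>' \<longleftrightarrow> \<tau> = subst_fm \<theta> \<tau>'"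
| "trace_step (EqL x y t u) \<tau> \<tau>' \<longleftrightarrow>
     (\<exists>\<phi>. \<tau> = subst_fm (subst2 x t y u) \<phi> \<and> \<tau>' = subst_fm (subst2 x u y t) \<phi>)"
| "trace_step (CaseTeF t y) \<tau> \<tau>' \<longleftrightarrow> progress (CaseTeF t y) \<tau> \<tau>' \<or> \<tau>' = \<tau>"
| "trace_step (CaseFsT t y) \<tau> \<tau>' \<longleftrightarrow> progress (CaseFsT t y) \<tau> \<tau>' \<or> \<tau>' = \<tau>"
| "trace_step _ \<tau> \<tau>' \<longleftrightarrow> \<tau>' = \<tau>"

definition inductive_atom :: "fm \<Rightarrow> bool" where
  "inductive_atom \<phi> \<longleftrightarrow> (\<exists>t. \<phi> = TeF t \<or> \<phi> = FsT t)"

definition trace :: "(nat \<Rightarrow> dtree) \<Rightarrow> (nat \<Rightarrow> fm) \<Rightarrow> bool" where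
  "trace \<pi> \<tau> \<longleftrightarrow>
     (\<forall>i. inductive_atom (\<tau> i) \<and> \<tau> i |\<in>| ante (root_sequent (\<pi> i)) \<and>
          trace_step (root_rule (\<pi> i)) (\<tau> i) (\<tau> (Suc i)))"

definition global_trace_condition :: "dtree \<Rightarrow> bool" where
  "global_trace_condition D \<longleftrightarrow>
     (\<forall>\<pi>. infinite_path D \<pi> \<longrightarrow>
        (\<exists>k \<tau>. trace (\<lambda>i. \<pi> (k + i)) \<tau> \<and>
               (\<exists>\<^sub>\<infinity>i. progress (root_rule (\<pi> (k + i))) (\<tau> i) (\<tau> (Suc i)))))"

definition cyclic_proof :: "ptree \<Rightarrow> (nat list \<Rightarrow> nat list) \<Rightarrow> bool" where
  "cyclic_proof T c \<longleftrightarrow> pre_proof T c \<and> global_trace_condition (tree_unfolding T c)"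

definition provable :: "sequent \<Rightarrow> bool" where
  "provable S \<longleftrightarrow> (\<exists>T c. cyclic_proof T c \<and> concl T = S)"

definition cut_free_provable :: "sequent \<Rightarrow> bool" where
  "cut_free_provable S \<longleftrightarrow> (\<exists>T c. cyclic_proof T c \<and> cut_free T \<and> concl T = S)"

end

theory Submission
  imports Defs "HOL-Library.Infinite_Set" "HOL-Library.Product_Lexorder"
begin

text \<open>With cut on \<open>FsT (Next y)\<close>, the sequent \<open>TeF x, FsT x \<turnstile> FsT End\<close> has a cyclic proof that
  unfolds \<open>TeF x\<close> once per round, and cut on \<open>FsT Start\<close> reduces the goal to it.

  Without cut, no \<open>FsT\<close> atom ever enters an antecedent and succedents contain nothing else. Consider
  the model consisting of a copy of the natural numbers starting at \<open>Start\<close> and a disjoint copy of the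
  integers around \<open>End\<close>; \<open>TeF\<close> fails only beyond \<open>End\<close>, and \<open>FsT\<close> holds only on the natural numbers.
  It refutes the goal, so one can follow refuted sequents upwards along an infinite path. At every
  sequent, each variable whose value the antecedent does not confine to a bounded initial segment of
  the natural numbers may be moved far to the left of \<open>End\<close>: this keeps the antecedent true, as
  its equations never link a moved variable to an unmoved natural number, and \<open>FsT\<close> becomes only
  falser. A cyclic proof has finitely many sequents, so all remaining natural values of \<open>TeF\<close> atoms
  have a common bound. Each progress point of a trace increases the value of its atom by one,
  towards that bound or towards \<open>End\<close>, so no trace progresses infinitely often.\<close>

subsection \<open>The proof with cut\<close>

lemma subtree_at_Bud: "subtree_at (Bud S) p = Some U \<longleftrightarrow> p = [] \<and> U = Bud S"
  by (cases p) auto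

lemma subtree_at_Inf:
  "subtree_at (Inf S r Ts) p = Some U \<longleftrightarrow>
     p = [] \<and> U = Inf S r Ts \<or>
     (\<exists>i q. p = i # q \<and> i < length Ts \<and> subtree_at (Ts ! i) q = Some U)"
  by (cases p) auto

text \<open>The half of \<open>pre_proof\<close> that does not involve companions; it relates a node
  only to its children and so passes to subtrees.\<close>

definition locally_correct :: "ptree \<Rightarrow> bool" where
  "locally_correct T \<longleftrightarrow>
     (\<forall>p S r Ts. subtree_at T p = Some (Inf S r Ts) \<longrightarrow> inference r (map concl Ts) S)"

lemma locally_correct_Bud: "locally_correct (Bud S)"
  by (simp add: locally_correct_def subtree_at_Bud)

lemma locally_correct_Inf:
  "locally_correct (Inf S r Ts) \<longleftrightarrow>
     inference r (map concl Ts) S \<and> (\<forall>T\<in>set Ts. locally_correct T)"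
proof
  assume correct: "locally_correct (Inf S r Ts)"
  then have "inference r (map concl Ts) S"
    unfolding locally_correct_def by (meson subtree_at.simps(1))
  moreover have "locally_correct T" if T: "T \<in> set Ts" for T
  proof -
    obtain i where "i < length Ts" "T = Ts ! i"
      using T unfolding in_set_conv_nth by blast
    then have "subtree_at (Inf S r Ts) (i # p) = subtree_at T p" for p
      by simp
    with correct show ?thesis
      unfolding locally_correct_def by metis
  qed
  ultimately show "inference r (map concl Ts) S \<and> (\<forall>T\<in>set Ts. locally_correct T)"
    by blast
next
  assume "inference r (map concl Ts) S \<and> (\<forall>T\<in>set Ts. locally_correct T)"
  then show "locally_correct (Inf S r Ts)"
    unfolding locally_correct_def subtree_at_Inf by (metis nth_mem ptree.inject(2))
qed

section \<open>The cyclic proof tree and its rule instances\<close>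

definition cycle_seq :: sequent where
  "cycle_seq = ({|TeF (Var 0), FsT (Var 0)|} \<turnstile> {|FsT End|})"

definition next_seq :: sequent where
  "next_seq = ({|TeF (Next (Var 2)), FsT (Var 2)|} \<turnstile> {|FsT End|})"

text \<open>In both uses of \<open>EqL\<close>, variable 3 marks the occurrence to be rewritten and
  variable 4 occurs nowhere in the contexts, so the equation acts in one direction only.\<close>

definition end_tree :: ptree where
  "end_tree = Inf ({|Var 0 \<doteq> End, FsT (Var 0)|} \<turnstile> {|FsT End|}) (EqL 3 4 (Var 0) End)
     [Inf ({|Var 0 \<doteq> End, FsT End|} \<turnstile> {|FsT End|}) Axiom []]"

definition succ_tree :: ptree where
  "succ_tree = Inf ({|TeF (Next (Var 2)), FsT (Var 2)|} \<turnstile> {|FsT (Next (Var 2)), FsT End|})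
     (FsTR2 (Var 2))
     [Inf ({|TeF (Next (Var 2)), FsT (Var 2)|} \<turnstile> {|FsT (Var 2), FsT End|}) Axiom []]"

text \<open>Weakening drops \<open>FsT (Var 2)\<close>; what remains is the instance of
  \<open>cycle_seq\<close> at \<open>Next (Var 2)\<close>, which closes the cycle.\<close>

definition loop_tree :: ptree where
  "loop_tree =
     Inf ({|FsT (Next (Var 2)), TeF (Next (Var 2)), FsT (Var 2)|} \<turnstile> {|FsT End|}) Weak
       [Inf ({|TeF (Next (Var 2)), FsT (Next (Var 2))|} \<turnstile> {|FsT End|}) (Subst (Var(0 := Next (Var 2))))
         [Bud cycle_seq]]"

definition step_tree :: ptree where
  "step_tree =
     Inf ({|Var 0 \<doteq> Var 2, TeF (Next (Var 2)), FsT (Var 0)|} \<turnstile> {|FsT End|}) (EqL 3 4 (Var 0) (Var 2))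
       [Inf ({|Var 0 \<doteq> Var 2, TeF (Next (Var 2)), FsT (Var 2)|} \<turnstile> {|FsT End|}) Weak
         [Inf next_seq (Cut (FsT (Next (Var 2)))) [succ_tree, loop_tree]]]"

definition cycle_tree :: ptree where
  "cycle_tree = Inf cycle_seq (CaseTeF (Var 0) 2) [end_tree, step_tree]"

definition cut_tree :: ptree where
  "cut_tree = Inf ({|TeF Start|} \<turnstile> {|FsT End|}) (Cut (FsT Start))
     [Inf ({|TeF Start|} \<turnstile> {|FsT Start, FsT End|}) FsTR1 [],
      Inf ({|TeF Start, FsT Start|} \<turnstile> {|FsT End|}) (Subst (Var(0 := Start))) [cycle_tree]]"

text \<open>The tree has a single bud, so a constant map suffices; \<open>[1, 0]\<close> is the
  address of \<open>cycle_tree\<close>.\<close>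

definition companion :: "nat list \<Rightarrow> nat list" where
  "companion p = [1, 0]"

lemmas tree_defs = cut_tree_def cycle_tree_def end_tree_def step_tree_def succ_tree_def
  loop_tree_def cycle_seq_def next_seq_def

lemma inference_end:
  "inference (EqL 3 4 (Var 0) End) [{|Var 0 \<doteq> End, FsT End|} \<turnstile> {|FsT End|}]
     ({|Var 0 \<doteq> End, FsT (Var 0)|} \<turnstile> {|FsT End|})"
  using inference.EqL[of 3 4 "Var 0" End "{|FsT (Var 3)|}" "{|FsT End|}"]
  by (simp add: subst2_def)

lemma inference_step:
  "inference (EqL 3 4 (Var 0) (Var 2))
     [{|Var 0 \<doteq> Var 2, TeF (Next (Var 2)), FsT (Var 2)|} \<turnstile> {|FsT End|}]
     ({|Var 0 \<doteq> Var 2, TeF (Next (Var 2)), FsT (Var 0)|} \<turnstile> {|FsT End|})"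
  using inference.EqL[of 3 4 "Var 0" "Var 2" "{|TeF (Next (Var 2)), FsT (Var 3)|}" "{|FsT End|}"]
  by (simp add: subst2_def)

lemma inference_cycle:
  "inference (CaseTeF (Var 0) 2)
     [{|Var 0 \<doteq> End, FsT (Var 0)|} \<turnstile> {|FsT End|},
      {|Var 0 \<doteq> Var 2, TeF (Next (Var 2)), FsT (Var 0)|} \<turnstile> {|FsT End|}]
     ({|TeF (Var 0), FsT (Var 0)|} \<turnstile> {|FsT End|})"
  by (rule inference.CaseTeF) (simp add: vars_fms_def)

lemma inference_subst:
  "inference (Subst (Var(0 := t))) [{|TeF (Var 0), FsT (Var 0)|} \<turnstile> {|FsT End|}]
     ({|TeF t, FsT t|} \<turnstile> {|FsT End|})"
  using inference.Subst[of "Var(0 := t)" "{|TeF (Var 0), FsT (Var 0)|}" "{|FsT End|}"] by simp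

lemma inference_cut_Start:
  "inference (Cut (FsT Start))
     [{|TeF Start|} \<turnstile> {|FsT Start, FsT End|}, {|TeF Start, FsT Start|} \<turnstile> {|FsT End|}]
     ({|TeF Start|} \<turnstile> {|FsT End|})"
  using inference.Cut[of "FsT Start" "{|TeF Start|}" "{|FsT End|}"]
  by (simp add: finsert_commute)

lemma pre_proof_cut_tree: "pre_proof cut_tree companion"
proof -
  have "locally_correct cut_tree"
    unfolding tree_defs
    by (auto simp: locally_correct_Inf locally_correct_Bud
        intro: inference_end inference_step inference_cycle inference_subst inference_cut_Start
          inference.intros)
  moreover have "\<exists>r Ts. subtree_at cut_tree (companion p) = Some (Inf S r Ts) \<and> Ts \<noteq> []"
    if "subtree_at cut_tree p = Some (Bud S)" for p S
    using that
    by (auto simp: tree_defs companion_def subtree_at_Inf subtree_at_Bud less_Suc_eq)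
  ultimately show ?thesis unfolding pre_proof_def locally_correct_def by blast
qed

section \<open>Infinite paths of the unfolding\<close>

abbreviation unf :: "nat list \<Rightarrow> dtree" where
  "unf \<equiv> unfolding_at cut_tree companion"

lemma children_unf:
  "children (unf []) = [unf [0], unf [1]]"
  "children (unf [0]) = []"
  "children (unf [1]) = [unf [1,0]]"
  "children (unf [1,0]) = [unf [1,0,0], unf [1,0,1]]"
  "children (unf [1,0,0]) = [unf [1,0,0,0]]"
  "children (unf [1,0,0,0]) = []"
  "children (unf [1,0,1]) = [unf [1,0,1,0]]"
  "children (unf [1,0,1,0]) = [unf [1,0,1,0,0]]"
  "children (unf [1,0,1,0,0]) = [unf [1,0,1,0,0,0], unf [1,0,1,0,0,1]]"
  "children (unf [1,0,1,0,0,0]) = [unf [1,0,1,0,0,0,0]]"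
  "children (unf [1,0,1,0,0,0,0]) = []"
  "children (unf [1,0,1,0,0,1]) = [unf [1,0,1,0,0,1,0]]"
  "children (unf [1,0,1,0,0,1,0]) = [unf [1,0,1,0,0,1,0,0]]"
  by (simp_all add: jump_def tree_defs)

text \<open>The bud jumps to its companion, so both trees have the same root and the same children,
  and comparing one layer suffices.\<close>

lemma unf_bud: "unf [1,0,1,0,0,1,0,0] = unf [1,0]"
  by (rule dtree.expand) (simp add: jump_def tree_defs companion_def)

lemma root_unf:
  "root_sequent (unf [1,0]) = cycle_seq"
  "root_rule (unf [1,0]) = CaseTeF (Var 0) 2"
  "root_rule (unf [1,0,1]) = EqL 3 4 (Var 0) (Var 2)"
  "root_rule (unf [1,0,1,0]) = Weak"
  "root_rule (unf [1,0,1,0,0]) = Cut (FsT (Next (Var 2)))"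
  "root_rule (unf [1,0,1,0,0,1]) = Weak"
  "root_rule (unf [1,0,1,0,0,1,0]) = Subst (Var(0 := Next (Var 2)))"
  "TeF (Next (Var 2)) |\<in>| ante (root_sequent (unf [1,0,1]))"
  "TeF (Next (Var 2)) |\<in>| ante (root_sequent (unf [1,0,1,0]))"
  "TeF (Next (Var 2)) |\<in>| ante (root_sequent (unf [1,0,1,0,0]))"
  "TeF (Next (Var 2)) |\<in>| ante (root_sequent (unf [1,0,1,0,0,1]))"
  "TeF (Next (Var 2)) |\<in>| ante (root_sequent (unf [1,0,1,0,0,1,0]))"
  by (simp_all add: jump_def tree_defs)

lemma infinite_path_shift:
  "infinite_path D \<pi> \<Longrightarrow> infinite_path (\<pi> i) (\<lambda>j. \<pi> (i + j))"
  by (simp add: infinite_path_def)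

definition live :: "dtree \<Rightarrow> bool" where
  "live D \<longleftrightarrow> (\<exists>\<pi>. infinite_path D \<pi>)"

lemma infinite_path_step:
  assumes "infinite_path D \<pi>"
  shows "\<pi> (Suc i) \<in> set (children (\<pi> i)) \<and> live (\<pi> (Suc i))"
proof
  show "\<pi> (Suc i) \<in> set (children (\<pi> i))"
    using assms by (simp add: infinite_path_def)
  show "live (\<pi> (Suc i))"
    using infinite_path_shift[OF assms, of "Suc i"] unfolding live_def by blast
qed

lemma live_child:
  assumes "live D"
  shows "\<exists>D'\<in>set (children D). live D'"
proof -
  obtain \<pi> where \<pi>: "infinite_path D \<pi>"
    using assms unfolding live_def by blast
  then have "\<pi> 0 = D"
    by (simp add: infinite_path_def)
  with infinite_path_step[OF \<pi>, of 0] show ?thesis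
    by blast
qed

text \<open>Each of these side branches has at most two nodes and ends in \<open>FsTR1\<close> or
  \<open>Axiom\<close>.\<close>

lemma dead_unf:
  "\<not> live (unf [0])" "\<not> live (unf [1,0,0])" "\<not> live (unf [1,0,1,0,0,0])"
proof -
  have "\<not> live (unf [1,0,0,0])" "\<not> live (unf [1,0,1,0,0,0,0])"
    using live_child children_unf by fastforce+
  then show "\<not> live (unf [0])" "\<not> live (unf [1,0,0])" "\<not> live (unf [1,0,1,0,0,0])"
    using live_child children_unf by fastforce+
qed

text \<open>At both branchings of the cycle, \<open>CaseTeF\<close> and \<open>Cut\<close>, one
  child is dead. So the path is forced, and it returns to the companion after six steps.\<close>

lemma loop_path:
  assumes "infinite_path (unf [1,0]) \<pi>"
  shows "\<pi> (6 * m) = unf [1,0]"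
    and "\<pi> (6 * m + 1) = unf [1,0,1]"
    and "\<pi> (6 * m + 2) = unf [1,0,1,0]"
    and "\<pi> (6 * m + 3) = unf [1,0,1,0,0]"
    and "\<pi> (6 * m + 4) = unf [1,0,1,0,0,1]"
    and "\<pi> (6 * m + 5) = unf [1,0,1,0,0,1,0]"
proof -
  note step = infinite_path_step[OF assms]
  have round:
    "\<pi> (n + 1) = unf [1,0,1]" "\<pi> (n + 2) = unf [1,0,1,0]" "\<pi> (n + 3) = unf [1,0,1,0,0]"
    "\<pi> (n + 4) = unf [1,0,1,0,0,1]" "\<pi> (n + 5) = unf [1,0,1,0,0,1,0]" "\<pi> (n + 6) = unf [1,0]"
    if n: "\<pi> n = unf [1,0]" for n
  proof -
    show 1: "\<pi> (n + 1) = unf [1,0,1]"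
      using step[of n] n dead_unf unfolding n children_unf by auto
    show 2: "\<pi> (n + 2) = unf [1,0,1,0]"
      using step[of "n + 1"] unfolding 1 children_unf by (auto simp: numeral_eq_Suc)
    show 3: "\<pi> (n + 3) = unf [1,0,1,0,0]"
      using step[of "n + 2"] unfolding 2 children_unf by (auto simp: numeral_eq_Suc)
    show 4: "\<pi> (n + 4) = unf [1,0,1,0,0,1]"
      using step[of "n + 3"] dead_unf unfolding 3 children_unf by (auto simp: numeral_eq_Suc)
    show 5: "\<pi> (n + 5) = unf [1,0,1,0,0,1,0]"
      using step[of "n + 4"] unfolding 4 children_unf by (auto simp: numeral_eq_Suc)
    show "\<pi> (n + 6) = unf [1,0]"
      using step[of "n + 5"] unfolding 5 children_unf unf_bud by (auto simp: numeral_eq_Suc)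
  qed
  show start: "\<pi> (6 * m) = unf [1,0]"
  proof (induction m)
    case 0
    then show ?case using assms by (simp add: infinite_path_def)
  next
    case (Suc m)
    then show ?case using round(6)[of "6 * m"] by (simp add: add.commute)
  qed
  show "\<pi> (6 * m + 1) = unf [1,0,1]" "\<pi> (6 * m + 2) = unf [1,0,1,0]"
    "\<pi> (6 * m + 3) = unf [1,0,1,0,0]" "\<pi> (6 * m + 4) = unf [1,0,1,0,0,1]"
    "\<pi> (6 * m + 5) = unf [1,0,1,0,0,1,0]"
    using round(1-5)[OF start] by blast+
qed

text \<open>In each round the atom progresses at \<open>CaseTeF\<close>, is carried along unchanged,
  and is turned back by \<open>Subst\<close>, since \<open>TeF (Next (Var 2))\<close> is an instance
  of \<open>TeF (Var 0)\<close>.\<close>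

definition loop_trace :: "nat \<Rightarrow> fm" where
  "loop_trace i = (if 6 dvd i then TeF (Var 0) else TeF (Next (Var 2)))"

lemma trace_loop:
  assumes "infinite_path (unf [1,0]) \<pi>"
  shows "trace \<pi> loop_trace"
  unfolding trace_def
proof (intro allI conjI)
  fix i
  show "inductive_atom (loop_trace i)"
    by (simp add: inductive_atom_def loop_trace_def)
  define m where "m = i div 6"
  have i: "i \<in> {6 * m, 6 * m + 1, 6 * m + 2, 6 * m + 3, 6 * m + 4, 6 * m + 5}"
    unfolding m_def by simp presburger
  note path = loop_path[OF assms, of m]
  have tr: "loop_trace (6 * m) = TeF (Var 0)"
    "loop_trace (Suc (6 * m)) = TeF (Next (Var 2))"
    "loop_trace (6 * m + 1) = TeF (Next (Var 2))"
    "loop_trace (6 * m + 2) = TeF (Next (Var 2))"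
    "loop_trace (6 * m + 3) = TeF (Next (Var 2))"
    "loop_trace (6 * m + 4) = TeF (Next (Var 2))"
    "loop_trace (6 * m + 5) = TeF (Next (Var 2))"
    "loop_trace (Suc (6 * m + 1)) = TeF (Next (Var 2))"
    "loop_trace (Suc (6 * m + 2)) = TeF (Next (Var 2))"
    "loop_trace (Suc (6 * m + 3)) = TeF (Next (Var 2))"
    "loop_trace (Suc (6 * m + 4)) = TeF (Next (Var 2))"
    "loop_trace (Suc (6 * m + 5)) = TeF (Var 0)"
    unfolding loop_trace_def by (simp_all; presburger)+
  \<comment> \<open>Neither placeholder 3 nor 4 occurs in the atom, so the atom itself is the
    witness.\<close>
  have eq: "trace_step (EqL 3 4 (Var 0) (Var 2)) (TeF (Next (Var 2))) (TeF (Next (Var 2)))"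
    by (simp, rule exI[of _ "TeF (Next (Var 2))"]) (simp add: subst2_def)
  show "loop_trace i |\<in>| ante (root_sequent (\<pi> i))"
    using i unfolding insert_iff empty_iff
    by (elim disjE FalseE; hypsubst) (simp_all only: path tr root_unf, simp add: cycle_seq_def)
  show "trace_step (root_rule (\<pi> i)) (loop_trace i) (loop_trace (Suc i))"
    using i unfolding insert_iff empty_iff
    by (elim disjE FalseE; hypsubst) (simp_all only: path tr root_unf eq, simp_all)
qed

lemma progress_loop:
  assumes "infinite_path (unf [1,0]) \<pi>"
  shows "\<exists>\<^sub>\<infinity>i. progress (root_rule (\<pi> i)) (loop_trace i) (loop_trace (Suc i))"
  unfolding INFM_nat
proof
  fix m
  have "loop_trace (6 * Suc m) = TeF (Var 0)"
    by (simp only: loop_trace_def dvd_triv_left if_True)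
  moreover have "loop_trace (Suc (6 * Suc m)) = TeF (Next (Var 2))"
    unfolding loop_trace_def by (simp, presburger)
  ultimately have
    "progress (root_rule (\<pi> (6 * Suc m))) (loop_trace (6 * Suc m)) (loop_trace (Suc (6 * Suc m)))"
    by (simp only: loop_path[OF assms] root_unf progress.simps)
  then show "\<exists>n>m. progress (root_rule (\<pi> n)) (loop_trace n) (loop_trace (Suc n))"
    by (intro exI[of _ "6 * Suc m"]) simp
qed

lemma cyclic_proof_cut_tree: "cyclic_proof cut_tree companion"
proof -
  have "\<exists>k \<tau>. trace (\<lambda>i. \<pi> (k + i)) \<tau> \<and>
      (\<exists>\<^sub>\<infinity>i. progress (root_rule (\<pi> (k + i))) (\<tau> i) (\<tau> (Suc i)))"
    if \<pi>: "infinite_path (unf []) \<pi>" for \<pi>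
  proof -
    note step = infinite_path_step[OF \<pi>]
    have 0: "\<pi> 0 = unf []"
      using \<pi> by (simp add: infinite_path_def)
    have 1: "\<pi> (Suc 0) = unf [1]"
      using step[of 0] dead_unf unfolding 0 children_unf by auto
    \<comment> \<open>The outer \<open>Cut\<close> and \<open>Subst\<close> precede the cycle, so
      the traced tail starts at 2.\<close>
    have "\<pi> 2 = unf [1,0]"
      using step[of "Suc 0"] unfolding 1 children_unf by (auto simp: numeral_eq_Suc)
    then have "infinite_path (unf [1,0]) (\<lambda>i. \<pi> (2 + i))"
      using infinite_path_shift[OF \<pi>, of 2] by simp
    then show ?thesis
      using trace_loop progress_loop by (intro exI[of _ 2] exI[of _ loop_trace]) blast
  qed
  then show ?thesis
    unfolding cyclic_proof_def global_trace_condition_def using pre_proof_cut_tree by blast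
qed

lemma provable_TeF_Start: "provable ({|TeF Start|} \<turnstile> {|FsT End|})"
  unfolding provable_def using cyclic_proof_cut_tree
  by (intro exI[of _ cut_tree] exI[of _ companion]) (simp add: cut_tree_def)

subsection \<open>A nonstandard model\<close>

text \<open>\<open>Std n\<close> is \<open>n\<close> steps after \<open>Start\<close> and \<open>Nst k\<close> is \<open>k\<close> steps after \<open>End\<close>, where \<open>k\<close> may be
  negative.\<close>

datatype val = Std nat | Nst int

primrec suc :: "val \<Rightarrow> val" where
  "suc (Std n) = Std (Suc n)"
| "suc (Nst k) = Nst (k + 1)"

primrec eval :: "(nat \<Rightarrow> val) \<Rightarrow> tm \<Rightarrow> val" where
  "eval \<rho> (Var x) = \<rho> x"
| "eval \<rho> Start = Std 0"
| "eval \<rho> End = Nst 0"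
| "eval \<rho> (Next t) = suc (eval \<rho> t)"

text \<open>\<open>TeF\<close> is a fixed point of its productions but not the least one, which
  would contain no \<open>Std\<close> value. Being a fixed point is what the case split of
  \<open>CaseTeF\<close> relies on.\<close>

primrec holds :: "(nat \<Rightarrow> val) \<Rightarrow> fm \<Rightarrow> bool" where
  "holds \<rho> (t \<doteq> u) \<longleftrightarrow> eval \<rho> t = eval \<rho> u"
| "holds \<rho> (TeF t) \<longleftrightarrow> (\<forall>k. eval \<rho> t = Nst k \<longrightarrow> k \<le> 0)"
| "holds \<rho> (FsT t) \<longleftrightarrow> (\<exists>n. eval \<rho> t = Std n)"

definition models :: "(nat \<Rightarrow> val) \<Rightarrow> fm fset \<Rightarrow> bool" where
  "models \<rho> \<Gamma> \<longleftrightarrow> (\<forall>\<phi>. \<phi> |\<in>| \<Gamma> \<longrightarrow> holds \<rho> \<phi>)"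

definition refutes :: "(nat \<Rightarrow> val) \<Rightarrow> sequent \<Rightarrow> bool" where
  "refutes \<rho> S \<longleftrightarrow> models \<rho> (ante S) \<and> (\<forall>\<phi>. \<phi> |\<in>| succ S \<longrightarrow> \<not> holds \<rho> \<phi>)"

definition is_FsT :: "fm \<Rightarrow> bool" where
  "is_FsT \<phi> \<longleftrightarrow> (\<exists>t. \<phi> = FsT t)"

text \<open>Passes from the conclusion to every premise of each rule other than \<open>Cut\<close>,
  and excludes all instances of \<open>EqR\<close>, \<open>TeFR1\<close>, \<open>TeFR2\<close> and
  \<open>CaseFsT\<close>.\<close>

definition FsT_right :: "sequent \<Rightarrow> bool" where
  "FsT_right S \<longleftrightarrow>
     (\<forall>\<phi>. \<phi> |\<in>| ante S \<longrightarrow> \<not> is_FsT \<phi>) \<and> (\<forall>\<phi>. \<phi> |\<in>| succ S \<longrightarrow> is_FsT \<phi>)"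

lemma suc_inject [simp]: "suc v = suc w \<longleftrightarrow> v = w"
  by (cases v; cases w) auto

lemma eval_subst: "eval \<rho> (subst_tm \<theta> t) = eval (\<lambda>x. eval \<rho> (\<theta> x)) t"
  by (induction t) auto

lemma holds_subst: "holds \<rho> (subst_fm \<theta> \<phi>) = holds (\<lambda>x. eval \<rho> (\<theta> x)) \<phi>"
  by (cases \<phi>) (auto simp: eval_subst)

lemma is_FsT_simps [simp]:
  "\<not> is_FsT (t \<doteq> u)" "\<not> is_FsT (TeF t)" "is_FsT (FsT t)"
  "is_FsT (subst_fm \<theta> \<phi>) \<longleftrightarrow> is_FsT \<phi>"
  by (cases \<phi>; auto simp: is_FsT_def)+

lemma eval_cong: "(\<And>x. x \<in> vars_tm t \<Longrightarrow> \<rho> x = \<rho>' x) \<Longrightarrow> eval \<rho> t = eval \<rho>' t"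
  by (induction t) auto

lemma holds_cong: "(\<And>x. x \<in> vars_fm \<phi> \<Longrightarrow> \<rho> x = \<rho>' x) \<Longrightarrow> holds \<rho> \<phi> = holds \<rho>' \<phi>"
  using eval_cong[of _ \<rho> \<rho>'] by (cases \<phi>) auto

lemma eval_subst2_swap:
  "eval \<rho> t = eval \<rho> u \<Longrightarrow> eval \<rho> (subst2 x u y t z) = eval \<rho> (subst2 x t y u z)"
  by (simp add: subst2_def)

text \<open>The right premise of \<open>CaseTeF t y\<close> contains \<open>TeF (Next y)\<close> with \<open>y\<close> valued like \<open>t\<close>, so progress
  moves the value of the traced term one step forward.\<close>

definition tracks :: "rule \<Rightarrow> (nat \<Rightarrow> val) \<Rightarrow> sequent \<Rightarrow> (nat \<Rightarrow> val) \<Rightarrow> sequent \<Rightarrow> bool" where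
  "tracks r \<rho> S \<rho>' S' \<longleftrightarrow>
     (\<forall>t t'. TeF t |\<in>| ante S \<and> TeF t' |\<in>| ante S' \<and> trace_step r (TeF t) (TeF t') \<longrightarrow>
        eval \<rho>' t' = (if progress r (TeF t) (TeF t') then suc (eval \<rho> t) else eval \<rho> t))"

text \<open>Local soundness, read upwards. \<open>Axiom\<close> and \<open>FsTR1\<close> never
  conclude a refuted sequent. Only \<open>CaseTeF\<close> offers a choice: the left premise if
  \<open>t\<close> has the value of \<open>End\<close>, otherwise the right one with
  \<open>y\<close> valued like \<open>t\<close>.\<close>

lemma refutes_premise:
  assumes "inference r Ss S" "FsT_right S" "refutes \<rho> S" "\<And>\<phi>. r \<noteq> Cut \<phi>"
  shows "\<exists>j \<rho>'. j < length Ss \<and> FsT_right (Ss ! j) \<and> refutes \<rho>' (Ss ! j) \<and> tracks r \<rho> S \<rho>' (Ss ! j)"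
  using assms
proof (induction rule: inference.induct)
  case (Axiom \<Gamma> \<Delta>)
  then show ?case by (auto simp: refutes_def models_def)
next
  case (Weak \<Gamma>' \<Gamma> \<Delta>' \<Delta>)
  then have "FsT_right (\<Gamma>' \<turnstile> \<Delta>')" "refutes \<rho> (\<Gamma>' \<turnstile> \<Delta>')"
    by (auto simp: refutes_def models_def FsT_right_def)
  moreover have "tracks Weak \<rho> (\<Gamma> \<turnstile> \<Delta>) \<rho> (\<Gamma>' \<turnstile> \<Delta>')"
    by (simp add: tracks_def)
  ultimately show ?case by auto
next
  case (Cut \<phi> \<Gamma> \<Delta>)
  then show ?case by blast
next
  case (Subst \<theta> \<Gamma> \<Delta>)
  let ?\<rho> = "\<lambda>x. eval \<rho> (\<theta> x)"
  from Subst have "FsT_right (\<Gamma> \<turnstile> \<Delta>)" "refutes ?\<rho> (\<Gamma> \<turnstile> \<Delta>)"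
    by (auto simp: refutes_def models_def FsT_right_def holds_subst)
  moreover have "tracks (Subst \<theta>) \<rho> (subst_fms \<theta> \<Gamma> \<turnstile> subst_fms \<theta> \<Delta>) ?\<rho> (\<Gamma> \<turnstile> \<Delta>)"
    by (simp add: tracks_def eval_subst)
  ultimately show ?case by auto
next
  case (EqL x y t u \<Gamma> \<Delta>)
  let ?\<theta> = "subst2 x t y u" and ?\<theta>' = "subst2 x u y t"
  have "eval \<rho> t = eval \<rho> u"
    using EqL by (auto simp: refutes_def models_def)
  \<comment> \<open>As \<open>t\<close> and \<open>u\<close> have equal values, both substitutions
    induce the same valuation; refutation and traced values carry over with \<rho>
    unchanged.\<close>
  then have swap: "(\<lambda>z. eval \<rho> (?\<theta>' z)) = (\<lambda>z. eval \<rho> (?\<theta> z))"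
    using eval_subst2_swap by blast
  from EqL have
    "FsT_right (finsert (t \<doteq> u) (subst_fms ?\<theta>' \<Gamma>) \<turnstile> subst_fms ?\<theta>' \<Delta>)"
    "refutes \<rho> (finsert (t \<doteq> u) (subst_fms ?\<theta>' \<Gamma>) \<turnstile> subst_fms ?\<theta>' \<Delta>)"
    by (auto simp: refutes_def models_def FsT_right_def holds_subst swap)
  moreover have "eval \<rho> a = eval \<rho> b" if "trace_step (EqL x y t u) (TeF a) (TeF b)" for a b
  proof -
    obtain \<phi> where "TeF a = subst_fm ?\<theta> \<phi>" "TeF b = subst_fm ?\<theta>' \<phi>"
      using \<open>trace_step (EqL x y t u) (TeF a) (TeF b)\<close> by auto
    then show ?thesis
      by (cases \<phi>) (auto simp: eval_subst swap)
  qed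
  then have "tracks (EqL x y t u) \<rho> (finsert (t \<doteq> u) (subst_fms ?\<theta> \<Gamma>) \<turnstile> subst_fms ?\<theta> \<Delta>)
      \<rho> (finsert (t \<doteq> u) (subst_fms ?\<theta>' \<Gamma>) \<turnstile> subst_fms ?\<theta>' \<Delta>)"
    unfolding tracks_def progress.simps by (metis (full_types))
  ultimately show ?case by auto
next
  case (EqR t \<Gamma> \<Delta>)
  then show ?case by (auto simp: FsT_right_def)
next
  case (TeFR1 \<Gamma> \<Delta>)
  then show ?case by (auto simp: FsT_right_def)
next
  case (TeFR2 t \<Gamma> \<Delta>)
  then show ?case by (auto simp: FsT_right_def)
next
  case (FsTR1 \<Gamma> \<Delta>)
  then show ?case by (auto simp: refutes_def)
next
  case (FsTR2 t \<Gamma> \<Delta>)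
  from FsTR2 have "FsT_right (\<Gamma> \<turnstile> finsert (FsT t) \<Delta>)" "refutes \<rho> (\<Gamma> \<turnstile> finsert (FsT t) \<Delta>)"
    by (auto simp: refutes_def FsT_right_def)
  moreover have "tracks (FsTR2 t) \<rho> (\<Gamma> \<turnstile> finsert (FsT (Next t)) \<Delta>) \<rho> (\<Gamma> \<turnstile> finsert (FsT t) \<Delta>)"
    by (simp add: tracks_def)
  ultimately show ?case by auto
next
  case (CaseTeF y \<Gamma> t \<Delta>)
  let ?S = "finsert (TeF t) \<Gamma> \<turnstile> \<Delta>"
  have fresh: "\<And>\<phi>. \<phi> |\<in>| \<Gamma> \<Longrightarrow> y \<notin> vars_fm \<phi>" "\<And>\<phi>. \<phi> |\<in>| \<Delta> \<Longrightarrow> y \<notin> vars_fm \<phi>" "y \<notin> vars_tm t"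
    using CaseTeF(1) by (auto simp: vars_fms_def)
  show ?case
  proof (cases "eval \<rho> t = Nst 0")
    case True
    let ?S' = "finsert (t \<doteq> End) \<Gamma> \<turnstile> \<Delta>"
    have "FsT_right ?S'" "refutes \<rho> ?S'"
      using CaseTeF True by (auto simp: refutes_def models_def FsT_right_def)
    \<comment> \<open>Progress would put \<open>TeF (Next (Var y))\<close> into \<Gamma>, against
      the freshness of \<open>y\<close>.\<close>
    moreover have "\<not> progress (CaseTeF t y) (TeF a) (TeF b)" if "TeF b |\<in>| \<Gamma>" for a b
      using fresh(1)[OF that] by auto
    then have "tracks (CaseTeF t y) \<rho> ?S \<rho> ?S'"
      by (auto simp: tracks_def)
    ultimately show ?thesis by (intro exI[of _ 0]) auto
  next
    case False
    let ?\<rho> = "\<rho>(y := eval \<rho> t)"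
    let ?S' = "finsert (t \<doteq> Var y) (finsert (TeF (Next (Var y))) \<Gamma>) \<turnstile> \<Delta>"
    have t: "eval ?\<rho> u = eval \<rho> u" if "y \<notin> vars_tm u" for u
      using that by (intro eval_cong) auto
    have "holds \<rho> (TeF t)"
      using CaseTeF by (auto simp: refutes_def models_def)
    then have "holds ?\<rho> (TeF (Next (Var y)))"
      using False by (cases "eval \<rho> t") auto
    moreover have "holds ?\<rho> \<phi> = holds \<rho> \<phi>" if "y \<notin> vars_fm \<phi>" for \<phi>
      using that by (intro holds_cong) auto
    ultimately have "FsT_right ?S'" "refutes ?\<rho> ?S'"
      using CaseTeF fresh t[OF fresh(3)] by (auto simp: refutes_def models_def FsT_right_def)
    moreover have "tracks (CaseTeF t y) \<rho> ?S ?\<rho> ?S'"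
      unfolding tracks_def
    proof (intro allI impI, elim conjE)
      fix a b
      assume a: "TeF a |\<in>| ante ?S" and step: "trace_step (CaseTeF t y) (TeF a) (TeF b)"
      \<comment> \<open>Whether \<open>a\<close> is \<open>t\<close> or comes from \<Gamma>,
        revaluing \<open>y\<close> leaves its value alone; moreover \<open>a\<close> cannot be its
        own case-descendant.\<close>
      have "y \<notin> vars_tm a"
        using a fresh by fastforce
      then show "eval ?\<rho> b =
          (if progress (CaseTeF t y) (TeF a) (TeF b) then suc (eval \<rho> a) else eval \<rho> a)"
        using step t[of a] by auto
    qed
    ultimately show ?thesis by (intro exI[of _ "Suc 0"]) auto
  qed
next
  case (CaseFsT y \<Gamma> t \<Delta>)
  then show ?case by (auto simp: FsT_right_def)
qed

subsection \<open>Moving unconstrained values into the nonstandard part\<close>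

text \<open>Being semantic, this notion respects chains of equations without any analysis of
  them.\<close>

definition bounded_by :: "nat \<Rightarrow> fm fset \<Rightarrow> tm \<Rightarrow> bool" where
  "bounded_by b \<Gamma> t \<longleftrightarrow> (\<forall>\<rho>. models \<rho> \<Gamma> \<longrightarrow> (\<exists>n\<le>b. eval \<rho> t = Std n))"

definition bounded :: "fm fset \<Rightarrow> tm \<Rightarrow> bool" where
  "bounded \<Gamma> t \<longleftrightarrow> (\<exists>b. bounded_by b \<Gamma> t)"

lemma bounded_by_mono: "bounded_by b \<Gamma> t \<Longrightarrow> b \<le> c \<Longrightarrow> bounded_by c \<Gamma> t"
  unfolding bounded_by_def by (meson le_trans)

lemma bounded_Start: "bounded \<Gamma> Start"
  by (auto simp: bounded_def bounded_by_def)

lemma bounded_Next: "bounded \<Gamma> (Next t) \<longleftrightarrow> bounded \<Gamma> t"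
proof
  assume "bounded \<Gamma> (Next t)"
  then obtain b where b: "bounded_by b \<Gamma> (Next t)"
    by (auto simp: bounded_def)
  have "\<exists>n\<le>b. eval \<rho> t = Std n" if "models \<rho> \<Gamma>" for \<rho>
  proof -
    from b that obtain n where "n \<le> b" "suc (eval \<rho> t) = Std n"
      by (auto simp: bounded_by_def)
    then show ?thesis by (cases "eval \<rho> t") auto
  qed
  then show "bounded \<Gamma> t"
    unfolding bounded_def bounded_by_def by blast
next
  assume "bounded \<Gamma> t"
  then obtain b where "bounded_by b \<Gamma> t"
    by (auto simp: bounded_def)
  then have "bounded_by (Suc b) \<Gamma> (Next t)"
    unfolding bounded_by_def by fastforce
  then show "bounded \<Gamma> (Next t)"
    unfolding bounded_def by blast
qed

text \<open>Keeps equations true under \<open>detach\<close>: their two sides are moved together or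
  not at all.\<close>

lemma bounded_Eq:
  assumes "(t \<doteq> u) |\<in>| \<Gamma>"
  shows "bounded \<Gamma> t \<longleftrightarrow> bounded \<Gamma> u"
proof -
  have "eval \<rho> t = eval \<rho> u" if "models \<rho> \<Gamma>" for \<rho>
    using that assms unfolding models_def by (metis holds.simps(1))
  then show ?thesis
    unfolding bounded_def bounded_by_def by metis
qed

text \<open>Embeds the standard part into the integers around \<open>End\<close>, with
  \<open>Start\<close> sent \<open>K\<close> steps before \<open>End\<close>.\<close>

definition shift :: "nat \<Rightarrow> val \<Rightarrow> val" where
  "shift K v = (case v of Std n \<Rightarrow> Nst (int n - int K) | Nst k \<Rightarrow> Nst k)"

definition detach :: "nat \<Rightarrow> fm fset \<Rightarrow> (nat \<Rightarrow> val) \<Rightarrow> nat \<Rightarrow> val" where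
  "detach K \<Gamma> \<rho> x = (if bounded \<Gamma> (Var x) then \<rho> x else shift K (\<rho> x))"

lemma shift_Nst [simp]: "shift K (Nst k) = Nst k"
  by (simp add: shift_def)

lemma shift_suc: "shift K (suc v) = suc (shift K v)"
  by (cases v) (auto simp: shift_def)

text \<open>Extends from variables to terms because \<open>shift\<close> commutes with
  \<open>suc\<close> and fixes \<open>End\<close>, \<open>Start\<close> is bounded, and
  \<open>Next\<close> does not affect boundedness.\<close>

lemma eval_detach: "eval (detach K \<Gamma> \<rho>) t = (if bounded \<Gamma> t then eval \<rho> t else shift K (eval \<rho> t))"
  by (induction t) (auto simp: detach_def bounded_Start bounded_Next shift_suc)

lemma fset_TeF_bound: "\<exists>K. \<forall>t n. TeF t |\<in>| \<Gamma> \<and> eval \<rho> t = Std n \<longrightarrow> n \<le> K"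
proof (induction \<Gamma>)
  case empty
  then show ?case by simp
next
  case (insert \<phi> \<Gamma>)
  then obtain K where K: "\<forall>t n. TeF t |\<in>| \<Gamma> \<and> eval \<rho> t = Std n \<longrightarrow> n \<le> K"
    by blast
  obtain L where L: "\<forall>t n. TeF t = \<phi> \<and> eval \<rho> t = Std n \<longrightarrow> n \<le> L"
  proof (cases "\<exists>t n. TeF t = \<phi> \<and> eval \<rho> t = Std n")
    case True
    then obtain n where "\<forall>t m. TeF t = \<phi> \<and> eval \<rho> t = Std m \<longrightarrow> m = n" by auto
    then show ?thesis by (intro that[of n]) auto
  qed (use that in blast)
  show ?case
    by (rule exI[of _ "max K L"]) (use K L in \<open>auto simp: le_max_iff_disj\<close>)
qed

text \<open>Choosing \<open>K\<close> above all standard values of \<open>TeF\<close> atoms puts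
  moved ones at or left of \<open>End\<close>, so they stay true. \<open>FsT\<close> can only become
  false, as \<open>shift\<close> never yields a \<open>Std\<close> value.\<close>

lemma refutes_detach:
  assumes "FsT_right S" "refutes \<rho> S"
  shows "\<exists>\<rho>'. refutes \<rho>' S \<and>
    (\<forall>t. eval \<rho>' t = eval \<rho> t \<and> bounded (ante S) t \<or>
      (\<exists>k. eval \<rho>' t = Nst k) \<and> (\<forall>k. eval \<rho> t = Nst k \<longrightarrow> eval \<rho>' t = Nst k))"
proof -
  obtain K where K: "\<forall>t n. TeF t |\<in>| ante S \<and> eval \<rho> t = Std n \<longrightarrow> n \<le> K"
    using fset_TeF_bound by blast
  let ?\<rho> = "detach K (ante S) \<rho>"
  have ante: "holds ?\<rho> \<phi>" if \<phi>: "\<phi> |\<in>| ante S" for \<phi>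
  proof (cases \<phi>)
    case (Eq t u)
    then have "eval \<rho> t = eval \<rho> u"
      using assms(2) \<phi> by (auto simp: refutes_def models_def)
    then show ?thesis
      using Eq bounded_Eq[of t u "ante S"] \<phi> by (simp add: eval_detach)
  next
    case (TeF t)
    then have "holds \<rho> (TeF t)"
      using assms(2) \<phi> by (auto simp: refutes_def models_def)
    moreover have "n \<le> K" if "eval \<rho> t = Std n" for n
      using K TeF \<phi> that by blast
    ultimately show ?thesis
      using TeF by (cases "eval \<rho> t") (auto simp: eval_detach shift_def)
  next
    case (FsT t)
    then show ?thesis
      using assms(1) \<phi> by (auto simp: FsT_right_def)
  qed
  have succ: "\<not> holds ?\<rho> \<phi>" if \<phi>: "\<phi> |\<in>| succ S" for \<phi>
  proof -
    obtain t where t: "\<phi> = FsT t"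
      using assms(1) \<phi> by (auto simp: FsT_right_def is_FsT_def)
    then have "\<not> holds \<rho> (FsT t)"
      using assms(2) \<phi> by (auto simp: refutes_def)
    then show ?thesis
      using t by (cases "eval \<rho> t") (auto simp: eval_detach shift_def)
  qed
  have "refutes ?\<rho> S"
    using ante succ by (simp add: refutes_def models_def)
  moreover have "eval ?\<rho> t = eval \<rho> t \<and> bounded (ante S) t \<or>
      (\<exists>k. eval ?\<rho> t = Nst k) \<and> (\<forall>k. eval \<rho> t = Nst k \<longrightarrow> eval ?\<rho> t = Nst k)" for t
    by (cases "eval \<rho> t") (auto simp: eval_detach shift_def)
  ultimately show ?thesis by blast
qed

subsection \<open>A path without progressing traces\<close>

text \<open>The lexicographic order on ranks reflects that a trace may move from \<open>Std\<close> to \<open>Nst\<close> values, at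
  most once and with arbitrary distance to \<open>End\<close>, but never back.\<close>

definition rank :: "nat \<Rightarrow> val \<Rightarrow> nat \<times> nat" where
  "rank B v = (case v of Std n \<Rightarrow> (1, B - n) | Nst k \<Rightarrow> (0, nat (- k)))"

text \<open>Once the least value is attained, a later strict drop would go below it.\<close>

lemma no_infinite_descent:
  fixes f :: "nat \<Rightarrow> 'a :: wellorder"
  assumes "\<And>i. f (Suc i) \<le> f i"
  shows "\<not> (\<exists>\<^sub>\<infinity>i. f (Suc i) < f i)"
proof
  assume inf: "\<exists>\<^sub>\<infinity>i. f (Suc i) < f i"
  define m where "m = (LEAST v. v \<in> range f)"
  have "m \<in> range f"
    unfolding m_def by (rule LeastI[of _ "f 0"]) simp
  then obtain i where i: "m = f i" by blast
  obtain j where j: "i < j" "f (Suc j) < f j"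
    using inf unfolding INFM_nat by blast
  have "f j \<le> f i"
    using lift_Suc_antimono_le[of f] assms j(1) by (meson less_imp_le)
  with i j have "f (Suc j) < m" by simp
  moreover have "m \<le> f (Suc j)"
    unfolding m_def by (rule Least_le) simp
  ultimately show False by simp
qed

section \<open>One bound for all sequents of a cyclic proof\<close>

lemma finite_subtrees: "finite {U. \<exists>p. subtree_at T p = Some U}"
proof (induction T)
  case (Bud S)
  then show ?case by (simp add: subtree_at_Bud)
next
  case (Inf S r Ts)
  have "{U. \<exists>p. subtree_at (Inf S r Ts) p = Some U} \<subseteq>
      insert (Inf S r Ts) (\<Union>T\<in>set Ts. {U. \<exists>p. subtree_at T p = Some U})"
    unfolding subtree_at_Inf using nth_mem by blast
  then show ?case
    by (rule finite_subset) (use Inf in auto)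
qed

lemma finite_uniform_bound:
  fixes P :: "'a \<Rightarrow> nat \<Rightarrow> bool"
  assumes "finite A" "\<And>a. a \<in> A \<Longrightarrow> \<exists>b. P a b" "\<And>a b c. P a b \<Longrightarrow> b \<le> c \<Longrightarrow> P a c"
  shows "\<exists>b. \<forall>a\<in>A. P a b"
  using assms(1,2)
proof (induction A)
  case empty
  then show ?case by simp
next
  case (insert a A)
  then obtain b c where "\<forall>a\<in>A. P a b" "P a c" by blast
  then have "\<forall>a\<in>insert a A. P a (max b c)"
    using assms(3) by (metis insert_iff max.cobounded1 max.cobounded2)
  then show ?case by blast
qed

text \<open>Here cyclicity enters: the unfolding only repeats sequents of the finite tree
  \<open>T\<close>, each with finitely many atoms, so the individual bounds have a common
  one.\<close>

lemma uniform_bound: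
  "\<exists>B. \<forall>p U t. subtree_at T p = Some U \<and> TeF t |\<in>| ante (concl U) \<and> bounded (ante (concl U)) t \<longrightarrow>
     bounded_by B (ante (concl U)) t"
proof -
  \<comment> \<open>Vacuous unless \<phi> is a bounded \<open>TeF\<close> atom, so every formula has
    some bound.\<close>
  define P where "P U \<phi> b \<longleftrightarrow>
    (\<forall>t. \<phi> = TeF t \<and> bounded (ante (concl U)) t \<longrightarrow> bounded_by b (ante (concl U)) t)" for U \<phi> b
  have mono: "P U \<phi> c" if "P U \<phi> b" "b \<le> c" for U \<phi> b c
    using that bounded_by_mono unfolding P_def by metis
  have formula: "\<exists>b. P U \<phi> b" for U \<phi>
    unfolding P_def bounded_def by (metis fm.inject(2))
  have sequent: "\<exists>b. \<forall>\<phi>\<in>fset (ante (concl U)). P U \<phi> b" for U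
    by (rule finite_uniform_bound[where P = "P U", OF finite_fset formula mono])
  have "\<exists>b. \<forall>U\<in>{U. \<exists>p. subtree_at T p = Some U}. \<forall>\<phi>\<in>fset (ante (concl U)). P U \<phi> b"
    by (rule finite_uniform_bound[OF finite_subtrees sequent]) (metis mono)
  then obtain b where b:
    "\<And>p U \<phi>. subtree_at T p = Some U \<Longrightarrow> \<phi> |\<in>| ante (concl U) \<Longrightarrow> P U \<phi> b"
    by blast
  show ?thesis
  proof (intro exI allI impI, elim conjE)
    fix p U t
    assume "subtree_at T p = Some U" "TeF t |\<in>| ante (concl U)" "bounded (ante (concl U)) t"
    then show "bounded_by b (ante (concl U)) t"
      using b[of p U "TeF t"] by (simp add: P_def)
  qed
qed

text \<open>The address \<open>p\<close> may be that of a bud, hence \<open>jump\<close>. The last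
  conjunct is what detaching achieves.\<close>

definition refuted_node ::
    "ptree \<Rightarrow> (nat list \<Rightarrow> nat list) \<Rightarrow> nat \<Rightarrow> nat list \<times> (nat \<Rightarrow> val) \<Rightarrow> bool" where
  "refuted_node T c B = (\<lambda>(p, \<rho>).
     \<exists>S r Ts. subtree_at T (jump T c p) = Some (Inf S r Ts) \<and> FsT_right S \<and> refutes \<rho> S \<and>
       (\<forall>t n. TeF t |\<in>| ante S \<and> eval \<rho> t = Std n \<longrightarrow> n \<le> B))"

text \<open>Phrased for the unfolding, to yield an infinite path directly. Considering
  \<open>TeF\<close> atoms is enough, as \<open>FsT_right\<close> keeps \<open>FsT\<close> out of
  antecedents.\<close>

definition rank_step ::
    "ptree \<Rightarrow> (nat list \<Rightarrow> nat list) \<Rightarrow> nat \<Rightarrow>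
     nat list \<times> (nat \<Rightarrow> val) \<Rightarrow> nat list \<times> (nat \<Rightarrow> val) \<Rightarrow> bool" where
  "rank_step T c B = (\<lambda>(p, \<rho>) (p', \<rho>').
     unfolding_at T c p' \<in> set (children (unfolding_at T c p)) \<and>
     (\<forall>t t'. TeF t |\<in>| ante (root_sequent (unfolding_at T c p)) \<and>
        TeF t' |\<in>| ante (root_sequent (unfolding_at T c p')) \<and>
        trace_step (root_rule (unfolding_at T c p)) (TeF t) (TeF t') \<longrightarrow>
        rank B (eval \<rho>' t') \<le> rank B (eval \<rho> t) \<and>
        (progress (root_rule (unfolding_at T c p)) (TeF t) (TeF t') \<longrightarrow>
           rank B (eval \<rho>' t') < rank B (eval \<rho> t))))"

lemma subtree_at_append:
  "subtree_at T (p @ q) = Option.bind (subtree_at T p) (\<lambda>U. subtree_at U q)"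
  by (induction T p rule: subtree_at.induct) auto

text \<open>A companion carries the sequent of its bud, so a jump keeps the sequent and reaches a
  rule.\<close>

lemma jump_Inf:
  assumes "pre_proof T c" "subtree_at T p = Some U"
  shows "\<exists>r Ts. subtree_at T (jump T c p) = Some (Inf (concl U) r Ts)"
proof (cases U)
  case (Bud S)
  with assms obtain r Ts where "subtree_at T (c p) = Some (Inf S r Ts)"
    unfolding pre_proof_def by metis
  then show ?thesis
    using assms(2) Bud by (simp add: jump_def)
next
  case (Inf S r Ts)
  then show ?thesis
    using assms by (auto simp: jump_def)
qed

text \<open>After detaching, only bounded terms keep standard values; \<rho> satisfies the
  antecedent, so \<open>B\<close> applies to those of \<open>TeF\<close> atoms.\<close>

lemma refuted_node_detach:
  assumes "pre_proof T c" "subtree_at T p = Some U" "FsT_right (concl U)" "refutes \<rho> (concl U)"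
    and B: "\<forall>p U t. subtree_at T p = Some U \<and> TeF t |\<in>| ante (concl U) \<and> bounded (ante (concl U)) t
      \<longrightarrow> bounded_by B (ante (concl U)) t"
  shows "\<exists>\<rho>'. refuted_node T c B (p, \<rho>') \<and> refutes \<rho>' (concl U) \<and>
    (\<forall>t. TeF t |\<in>| ante (concl U) \<longrightarrow> (\<exists>n\<le>B. eval \<rho> t = Std n) \<and> eval \<rho>' t = eval \<rho> t \<or>
      (\<exists>k. eval \<rho>' t = Nst k) \<and> (\<forall>k. eval \<rho> t = Nst k \<longrightarrow> eval \<rho>' t = Nst k))"
proof -
  let ?\<Gamma> = "ante (concl U)"
  obtain \<rho>' where \<rho>': "refutes \<rho>' (concl U)" and eval: "\<And>t. eval \<rho>' t = eval \<rho> t \<and> bounded ?\<Gamma> t \<or>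
      (\<exists>k. eval \<rho>' t = Nst k) \<and> (\<forall>k. eval \<rho> t = Nst k \<longrightarrow> eval \<rho>' t = Nst k)"
    using refutes_detach[OF assms(3,4)] by blast
  have models: "models \<rho> ?\<Gamma>"
    using assms(4) by (simp add: refutes_def)
  have bound: "\<exists>n\<le>B. eval \<rho> t = Std n" if "TeF t |\<in>| ?\<Gamma>" "bounded ?\<Gamma> t" for t
    using B assms(2) that models unfolding bounded_by_def by blast
  have eval': "(\<exists>n\<le>B. eval \<rho> t = Std n) \<and> eval \<rho>' t = eval \<rho> t \<or>
      (\<exists>k. eval \<rho>' t = Nst k) \<and> (\<forall>k. eval \<rho> t = Nst k \<longrightarrow> eval \<rho>' t = Nst k)"
    if "TeF t |\<in>| ?\<Gamma>" for t
    using eval[of t] bound[OF that] by blast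
  obtain r Ts where "subtree_at T (jump T c p) = Some (Inf (concl U) r Ts)"
    using jump_Inf[OF assms(1,2)] by blast
  moreover have "n \<le> B" if "TeF t |\<in>| ?\<Gamma>" "eval \<rho>' t = Std n" for t n
    using eval'[OF that(1)] that(2) by auto
  ultimately have "refuted_node T c B (p, \<rho>')"
    using assms(3) \<rho>' by (auto simp: refuted_node_def)
  with \<rho>' eval' show ?thesis by blast
qed

text \<open>First \<open>refutes_premise\<close> chooses a premise, then detaching restores the
  bound \<open>B\<close>; neither raises the rank of a traced atom.\<close>

lemma refuted_node_step:
  assumes "pre_proof T c" "cut_free T" "refuted_node T c B s"
    and B: "\<forall>p U t. subtree_at T p = Some U \<and> TeF t |\<in>| ante (concl U) \<and> bounded (ante (concl U)) t
      \<longrightarrow> bounded_by B (ante (concl U)) t"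
  shows "\<exists>s'. refuted_node T c B s' \<and> rank_step T c B s s'"
proof -
  obtain p \<rho> where s: "s = (p, \<rho>)" by fastforce
  let ?q = "jump T c p"
  obtain S r Ts where node: "subtree_at T ?q = Some (Inf S r Ts)" and S: "FsT_right S" "refutes \<rho> S"
    and \<rho>B: "\<And>t n. TeF t |\<in>| ante S \<Longrightarrow> eval \<rho> t = Std n \<Longrightarrow> n \<le> B"
    using assms(3) by (auto simp: s refuted_node_def)
  have "inference r (map concl Ts) S"
    using assms(1) node unfolding pre_proof_def by blast
  moreover have "r \<noteq> Cut \<phi>" for \<phi>
    using assms(2) node unfolding cut_free_def by blast
  ultimately obtain j \<rho>\<^sub>1 where j: "j < length Ts" "FsT_right (concl (Ts ! j))"
    "refutes \<rho>\<^sub>1 (concl (Ts ! j))" "tracks r \<rho> S \<rho>\<^sub>1 (concl (Ts ! j))"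
    using refutes_premise[OF _ S] by fastforce
  let ?p' = "?q @ [j]" and ?S' = "concl (Ts ! j)"
  have sub: "subtree_at T ?p' = Some (Ts ! j)"
    using node j(1) by (simp add: subtree_at_append)
  obtain \<rho>' where \<rho>': "refuted_node T c B (?p', \<rho>')" "refutes \<rho>' ?S'"
    and eval: "\<And>t. TeF t |\<in>| ante ?S' \<Longrightarrow> (\<exists>n\<le>B. eval \<rho>\<^sub>1 t = Std n) \<and> eval \<rho>' t = eval \<rho>\<^sub>1 t \<or>
      (\<exists>k. eval \<rho>' t = Nst k) \<and> (\<forall>k. eval \<rho>\<^sub>1 t = Nst k \<longrightarrow> eval \<rho>' t = Nst k)"
    using refuted_node_detach[OF assms(1) sub j(2,3) B] by blast
  obtain r' Ts' where node': "subtree_at T (jump T c ?p') = Some (Inf ?S' r' Ts')"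
    using jump_Inf[OF assms(1) sub] by blast
  have "rank B (eval \<rho>' t') \<le> rank B (eval \<rho> t) \<and>
      (progress r (TeF t) (TeF t') \<longrightarrow> rank B (eval \<rho>' t') < rank B (eval \<rho> t))"
    if t: "TeF t |\<in>| ante S" "TeF t' |\<in>| ante ?S'" "trace_step r (TeF t) (TeF t')" for t t'
  proof -
    have \<rho>\<^sub>1: "eval \<rho>\<^sub>1 t' = (if progress r (TeF t) (TeF t') then suc (eval \<rho> t) else eval \<rho> t)"
      using j(4) t unfolding tracks_def by blast
    have le0: "k \<le> 0" if "eval \<rho>' t' = Nst k" for k
      using \<rho>'(2) t(2) that unfolding refutes_def models_def by (metis holds.simps(2))
    \<comment> \<open>A value that stays standard is at most \<open>B\<close> by
      \<open>eval\<close>, and a nonstandard one is at most 0 by \<open>le0\<close>. Hence the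
      truncated \<open>B - n\<close> and \<open>nat (- k)\<close> really drop on progress.\<close>
    show ?thesis
    proof (cases "eval \<rho> t")
      case (Std n)
      then show ?thesis
        using eval[OF t(2)] \<rho>\<^sub>1 by (auto simp: rank_def split: if_splits)
    next
      case (Nst k)
      then show ?thesis
        using eval[OF t(2)] \<rho>\<^sub>1 le0 by (auto simp: rank_def split: if_splits)
    qed
  qed
  moreover have "unfolding_at T c ?p' \<in> set (children (unfolding_at T c p))"
    using node j(1) by auto
  ultimately have "rank_step T c B s (?p', \<rho>')"
    using node node' by (simp add: rank_step_def s)
  with \<rho>'(1) show ?thesis by blast
qed

lemma not_cut_free_provable_refuted:
  assumes "FsT_right S" "refutes \<rho> S"
  shows "\<not> cut_free_provable S"
proof
  assume "cut_free_provable S"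
  then obtain T c where T: "pre_proof T c" "global_trace_condition (tree_unfolding T c)"
    "cut_free T" "concl T = S"
    by (auto simp: cut_free_provable_def cyclic_proof_def)
  obtain B where B: "\<forall>p U t. subtree_at T p = Some U \<and> TeF t |\<in>| ante (concl U) \<and>
      bounded (ante (concl U)) t \<longrightarrow> bounded_by B (ante (concl U)) t"
    using uniform_bound by blast
  obtain \<rho>\<^sub>0 where "refuted_node T c B ([], \<rho>\<^sub>0)"
    using refuted_node_detach[OF T(1) _ _ _ B, of "[]" T \<rho>] assms T(4) by auto
  \<comment> \<open>Dependent choice; the clause for \<open>i = 0\<close> pins the path to the
    root.\<close>
  then have "\<exists>f. \<forall>i. (refuted_node T c B (f i) \<and> (i = 0 \<longrightarrow> fst (f i) = [])) \<and>
      rank_step T c B (f i) (f (Suc i))"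
    using refuted_node_step[OF T(1,3) _ B]
    by (intro dependent_nat_choice[where P = "\<lambda>i s. refuted_node T c B s \<and> (i = 0 \<longrightarrow> fst s = [])"
          and Q = "\<lambda>i. rank_step T c B"]) fastforce+
  then obtain f where f: "\<And>i. refuted_node T c B (f i)" "fst (f 0) = []"
    "\<And>i. rank_step T c B (f i) (f (Suc i))"
    by blast
  define \<pi> where "\<pi> i = unfolding_at T c (fst (f i))" for i
  have "infinite_path (tree_unfolding T c) \<pi>"
    using f(2,3) by (auto simp: infinite_path_def \<pi>_def rank_step_def split_beta)
  then obtain k \<tau> where \<tau>: "trace (\<lambda>i. \<pi> (k + i)) \<tau>"
    and inf: "\<exists>\<^sub>\<infinity>i. progress (root_rule (\<pi> (k + i))) (\<tau> i) (\<tau> (Suc i))"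
    using T(2) unfolding global_trace_condition_def by blast
  \<comment> \<open>Antecedents on the path contain no \<open>FsT\<close> atom, so the trace has
    only \<open>TeF\<close> atoms.\<close>
  have "\<exists>t. \<tau> i = TeF t" for i
  proof -
    obtain S' r Ts where "subtree_at T (jump T c (fst (f (k + i)))) = Some (Inf S' r Ts)" "FsT_right S'"
      using f(1)[of "k + i"] by (auto simp: refuted_node_def split_beta)
    moreover have "inductive_atom (\<tau> i)" "\<tau> i |\<in>| ante (root_sequent (\<pi> (k + i)))"
      using \<tau> by (auto simp: trace_def)
    ultimately show ?thesis
      by (auto simp: \<pi>_def FsT_right_def inductive_atom_def)
  qed
  then obtain t where t: "\<And>i. \<tau> i = TeF (t i)" by metis
  define v where "v i = rank B (eval (snd (f (k + i))) (t i))" for i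
  have "v (Suc i) \<le> v i \<and> (progress (root_rule (\<pi> (k + i))) (\<tau> i) (\<tau> (Suc i)) \<longrightarrow> v (Suc i) < v i)" for i
  proof -
    have "TeF (t i) |\<in>| ante (root_sequent (\<pi> (k + i)))"
      "TeF (t (Suc i)) |\<in>| ante (root_sequent (\<pi> (Suc (k + i))))"
      "trace_step (root_rule (\<pi> (k + i))) (TeF (t i)) (TeF (t (Suc i)))"
      using \<tau> t unfolding trace_def by (metis add_Suc_right)+
    then show ?thesis
      using f(3)[of "k + i"] unfolding rank_step_def split_beta v_def \<pi>_def t add_Suc_right by blast
  qed
  then have "\<not> (\<exists>\<^sub>\<infinity>i. v (Suc i) < v i)" "\<exists>\<^sub>\<infinity>i. v (Suc i) < v i"
    using no_infinite_descent[of v] inf by (auto elim: INFM_mono)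
  then show False by blast
qed

theorem theorem1:
  shows "provable ({|TeF Start|} \<turnstile> {|FsT End|}) \<and>
         \<not> cut_free_provable ({|TeF Start|} \<turnstile> {|FsT End|})"
proof
  show "provable ({|TeF Start|} \<turnstile> {|FsT End|})"
    by (rule provable_TeF_Start)
  have "FsT_right ({|TeF Start|} \<turnstile> {|FsT End|})"
    by (auto simp: FsT_right_def)
  \<comment> \<open>The sequent is closed, so any valuation serves: \<open>Start\<close> is
    \<open>Std 0\<close> and \<open>End\<close> is \<open>Nst 0\<close>.\<close>
  moreover have "refutes \<rho> ({|TeF Start|} \<turnstile> {|FsT End|})" for \<rho>
    by (auto simp: refutes_def models_def)
  ultimately show "\<not> cut_free_provable ({|TeF Start|} \<turnstile> {|FsT End|})"
    by (rule not_cut_free_provable_refuted)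
qed

end
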